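(* There exist a full measure set $E \subset [0,1]\times\mathbb{T}^2$ and a family $\{\Gamma_\beta\}_{\beta}$ of pairwise disjoint curves in $[0,1]\times\mathbb{T}^2$ which fill out $[0,1]\times\mathbb{T}^2$, i.e. $\bigcup_\beta \Gamma_\beta = [0,1]\times\mathbb{T}^2$, such that each curve $\Gamma_\beta$ intersects $E$ in at most a single point.
   Context: Here $\mathbb{T}^2=\mathbb{R}^2/\mathbb{Z}^2$ is the two-dimensional torus. "Full measure" is with respect to three-dimensional Lebesgue measure on $[0,1]\times\mathbb{T}^2$ (the product of Lebesgue measure on $[0,1]$ and Lebesgue measure on $\mathbb{T}^2$): $E$ is measurable and its complement has measure zero. A curve in $[0,1]\times\mathbb{T}^2$ means the image of a continuous injective map $[0,1]\to[0,1]\times\mathbb{T}^2$ (in particular, it is not a single point). *)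

theory Defs
  imports "HOL-Analysis.Analysis"
begin

definition int_equiv :: "real \<times> real \<Rightarrow> real \<times> real \<Rightarrow> bool"
  where "int_equiv x y \<longleftrightarrow> fst x - fst y \<in> \<int> \<and> snd x - snd y \<in> \<int>"

lemma equivp_int_equiv: "equivp int_equiv"
proof (rule equivpI)
  show "reflp int_equiv"
    by (auto simp: reflp_def int_equiv_def)
  show "symp int_equiv"
    by (auto simp: symp_def int_equiv_def) (metis Ints_minus minus_diff_eq)+
  show "transp int_equiv"
  proof (rule transpI)
    fix x y z assume "int_equiv x y" "int_equiv y z"
    then have "(fst x - fst y) + (fst y - fst z) \<in> \<int>" "(snd x - snd y) + (snd y - snd z) \<in> \<int>"
      unfolding int_equiv_def by (blast intro: Ints_add)+
    then show "int_equiv x z"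
      by (simp add: int_equiv_def)
  qed
qed

quotient_type torus2 = "real \<times> real" / int_equiv
  by (rule equivp_int_equiv)

definition torus_proj :: "real \<times> real \<Rightarrow> torus2"
  where "torus_proj = abs_torus2"

lemma torus_proj_eq_iff: "torus_proj x = torus_proj y \<longleftrightarrow> int_equiv x y"
  by (simp add: torus_proj_def torus2.abs_eq_iff)

lemma surj_torus_proj: "surj torus_proj"
  unfolding torus_proj_def by (metis Quotient_abs_rep Quotient_torus2 surjI)

instantiation torus2 :: topological_space
begin

definition open_torus2 :: "torus2 set \<Rightarrow> bool"
  where "open_torus2 U \<longleftrightarrow> open (torus_proj -` U)"

instance
proof
  show "open (UNIV :: torus2 set)"
    by (simp add: open_torus2_def)
  show "open (S \<inter> T)" if "open S" "open T" for S T :: "torus2 set"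
    using that by (simp add: open_torus2_def vimage_Int open_Int)
  show "open (\<Union>K)" if "\<forall>S\<in>K. open S" for K :: "torus2 set set"
    using that by (simp add: open_torus2_def vimage_Union open_UN)
qed

end

lemma continuous_on_torus_proj: "continuous_on A torus_proj"
  by (rule continuous_on_subset[of UNIV])
     (auto simp: continuous_on_open_vimage open_torus2_def)

text \<open>Lebesgue measure on the torus is transported from the fundamental domain
  $[0,1)^2$, on which the projection is bijective.\<close>

definition torus_lborel :: "torus2 measure"
  where "torus_lborel = distr (restrict_space lborel ({0..<1} \<times> {0..<1})) borel torus_proj"

lemma torus_proj_measurable:
  "torus_proj \<in> restrict_space lborel ({0..<1} \<times> {0..<1}) \<rightarrow>\<^sub>M borel"
proof -
  have "torus_proj \<in> lborel \<rightarrow>\<^sub>M borel"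
    using borel_measurable_continuous_onI[OF continuous_on_torus_proj] by simp
  then show ?thesis
    by (rule measurable_restrict_space1)
qed

text \<open>The completion makes the measurable sets the Lebesgue measurable ones
  rather than only the product Borel ones.\<close>

definition cylinder_lebesgue :: "(real \<times> torus2) measure"
  where "cylinder_lebesgue = completion (restrict_space lborel {0..1} \<Otimes>\<^sub>M torus_lborel)"

definition full_measure :: "(real \<times> torus2) set \<Rightarrow> bool"
  where "full_measure E \<longleftrightarrow>
    E \<in> sets cylinder_lebesgue \<and> emeasure cylinder_lebesgue (space cylinder_lebesgue - E) = 0"

lemma space_cylinder_lebesgue: "space cylinder_lebesgue = {0..1} \<times> UNIV"
  by (simp add: cylinder_lebesgue_def torus_lborel_def space_pair_measure space_restrict_space)

lemma emeasure_cylinder_lebesgue_space: "emeasure cylinder_lebesgue (space cylinder_lebesgue) = 1"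
proof -
  let ?Q = "{0..<1} \<times> {0..<1} :: (real \<times> real) set"
  have Q: "emeasure lborel ?Q = 1"
  proof -
    have "emeasure lborel ?Q = emeasure (lborel \<Otimes>\<^sub>M lborel) ?Q"
      by (simp add: lborel_prod)
    also have "\<dots> = 1"
      by (subst lborel.emeasure_pair_measure_Times) auto
    finally show ?thesis .
  qed
  have Qs: "?Q \<in> sets lborel"
    by (simp add: borel_Times)
  have T: "emeasure torus_lborel UNIV = 1"
    using Q Qs unfolding torus_lborel_def
    by (subst emeasure_distr[OF torus_proj_measurable])
       (auto simp: emeasure_restrict_space space_restrict_space)
  interpret T: finite_measure torus_lborel
    by (rule finite_measureI) (use T in \<open>simp add: torus_lborel_def\<close>)
  have "emeasure (restrict_space lborel {0..1} \<Otimes>\<^sub>M torus_lborel) ({0..1::real} \<times> UNIV) = 1"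
    using T by (subst T.emeasure_pair_measure_Times)
      (auto simp: sets_restrict_space emeasure_restrict_space torus_lborel_def)
  moreover have "{0..1::real} \<times> UNIV \<in> sets (restrict_space lborel {0..1} \<Otimes>\<^sub>M torus_lborel)"
    by (rule pair_measureI) (auto simp: sets_restrict_space torus_lborel_def)
  ultimately show ?thesis
    by (simp add: space_cylinder_lebesgue) (simp add: cylinder_lebesgue_def)
qed

definition curve_in_cylinder :: "(real \<times> torus2) set \<Rightarrow> bool"
  where "curve_in_cylinder C \<longleftrightarrow> C \<subseteq> {0..1} \<times> UNIV \<and> (\<exists>g. arc g \<and> path_image g = C)"

end

theory Submission
  imports Defs
begin

text \<open>
  The construction is a version of the example of Katok that Milnor described in his article
  Fubini foiled. For a parameter \<open>p\<close> strictly between \<open>0\<close> and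
  \<open>1\<close>, cut the unit interval at \<open>p\<close> and let \<open>expand p\<close> map
  each of the two pieces affinely onto the whole interval. Recording at each step whether the
  orbit of \<open>x\<close> lies in the left or in the right piece codes \<open>x\<close> by a
  sequence of bits. Under Lebesgue measure these bits are independent, each of them being a right
  turn with probability \<open>1 - p\<close>; so for almost every \<open>x\<close> the frequency
  of right turns is \<open>1 - p\<close>, and the sequence alone determines \<open>p\<close>.

  On the other hand, the set of sequences that occur as codes is the same for all \<open>p\<close>: they are
  those with infinitely many left turns (lemmas \<open>itinerary_decode\<close>, \<open>decode_itinerary\<close> and
  \<open>itinerary_frequently_left\<close>).  The point with a given code depends continuously on \<open>p\<close>, being
  the sum of a uniformly convergent series (\<open>continuous_on_decode\<close>).  So if the code and the
  second torus coordinate are kept fixed, while \<open>p\<close> is an injective continuous function \<open>weight t\<close>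
  of time with values in a compact part of the open unit interval, the point moves along a
  curve that is a graph over the time interval.  These curves are the fibres of one map \<open>code\<close>
  on the product of the time interval and the torus, and hence partition it.

  Let \<open>E\<close> be the set of points whose code has the right frequency for their own time.  By the
  law of large numbers on each time slice and Fubini's theorem it has full measure.  Two points
  of \<open>E\<close> on one curve have the same code, hence the same frequency, hence the same time; since
  the curve is a graph over time, they coincide.
\<close>

section \<open>Coding the unit interval by an expanding map\<close>

definition expand :: "real \<Rightarrow> real \<Rightarrow> real"
  where "expand p x = (if p \<le> x then (x - p) / (1 - p) else x / p)"

definition itinerary :: "real \<Rightarrow> real \<Rightarrow> nat \<Rightarrow> bool"
  where "itinerary p x n \<longleftrightarrow> p \<le> (expand p ^^ n) x"

text \<open>The length of the interval of points whose code begins with the first \<open>n\<close> entries of \<open>a\<close>.\<close>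

definition prefix_width :: "real \<Rightarrow> (nat \<Rightarrow> bool) \<Rightarrow> nat \<Rightarrow> real"
  where "prefix_width p a n = (\<Prod>i<n. if a i then 1 - p else p)"

text \<open>Each right turn moves the left end of the interval of candidates by a proportion \<open>p\<close> of
  its current length; the sum of these shifts is the point coded by \<open>a\<close>.\<close>

definition decode :: "real \<Rightarrow> (nat \<Rightarrow> bool) \<Rightarrow> real"
  where "decode p a = (\<Sum>n. of_bool (a n) * p * prefix_width p a n)"

lemma itinerary_0: "itinerary p x 0 \<longleftrightarrow> p \<le> x"
  by (simp add: itinerary_def)

lemma itinerary_Suc: "itinerary p x (Suc n) = itinerary p (expand p x) n"
  by (simp add: itinerary_def funpow_swap1)

lemma prefix_width_0: "prefix_width p a 0 = 1"
  by (simp add: prefix_width_def)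

lemma prefix_width_Suc_shift:
  "prefix_width p a (Suc n) = (if a 0 then 1 - p else p) * prefix_width p (\<lambda>i. a (Suc i)) n"
  unfolding prefix_width_def by (simp add: prod.lessThan_Suc_shift del: prod.lessThan_Suc)

lemma prefix_width_nonneg:
  assumes "0 \<le> p" "p \<le> 1"
  shows "0 \<le> prefix_width p a n"
  unfolding prefix_width_def using assms by (intro prod_nonneg) auto

lemma prefix_width_le_power:
  assumes "0 \<le> p" "p \<le> 1" "p \<le> r" "1 - p \<le> r"
  shows "prefix_width p a n \<le> r ^ n"
proof -
  have "prefix_width p a n \<le> (\<Prod>i<n. r)"
    unfolding prefix_width_def using assms by (intro prod_mono) auto
  then show ?thesis by simp
qed

lemma decode_term_bound:
  assumes "0 \<le> p" "p \<le> 1" "p \<le> r" "1 - p \<le> r"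
  shows "norm (of_bool (a n) * p * prefix_width p a n) \<le> r ^ n"
proof -
  have "of_bool (a n) * p * prefix_width p a n \<le> 1 * prefix_width p a n"
    using assms prefix_width_nonneg[of p a n] by (intro mult_right_mono) auto
  then show ?thesis
    using prefix_width_le_power[OF assms, of a n] prefix_width_nonneg[of p a n] assms by simp
qed

lemma decode_summable:
  assumes "0 < p" "p < 1"
  shows "summable (\<lambda>n. of_bool (a n) * p * prefix_width p a n)"
  using decode_term_bound[of p "max p (1 - p)" a] assms
  by (intro summable_comparison_test'[OF summable_geometric[of "max p (1 - p)"], of 0]) auto

lemma decode_unfold:
  assumes "0 < p" "p < 1"
  shows "decode p a = (if a 0 then p + (1 - p) * decode p (\<lambda>i. a (Suc i))
                              else p * decode p (\<lambda>i. a (Suc i)))"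
proof -
  let ?w = "if a 0 then 1 - p else p" and ?b = "\<lambda>i. a (Suc i)"
  have "decode p a = of_bool (a 0) * p + (\<Sum>n. of_bool (a (Suc n)) * p * prefix_width p a (Suc n))"
    unfolding decode_def
    using suminf_split_head[OF decode_summable[OF assms, of a]] by (simp add: prefix_width_0)
  also have "(\<Sum>n. of_bool (a (Suc n)) * p * prefix_width p a (Suc n))
      = (\<Sum>n. ?w * (of_bool (?b n) * p * prefix_width p ?b n))"
    by (simp add: prefix_width_Suc_shift mult_ac)
  also have "\<dots> = ?w * decode p ?b"
    unfolding decode_def by (rule suminf_mult[OF decode_summable[OF assms]])
  finally show ?thesis by simp
qed

lemma decode_nonneg:
  assumes "0 < p" "p < 1"
  shows "0 \<le> decode p a"
  unfolding decode_def
  using assms by (intro suminf_nonneg decode_summable) (auto simp: prefix_width_nonneg)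

text \<open>The partial sums are the left ends of intervals that all lie inside \<open>[0,1]\<close>.\<close>

lemma decode_le_1:
  assumes "0 < p" "p < 1"
  shows "decode p a \<le> 1"
proof -
  have "(\<Sum>i<n. of_bool (a i) * p * prefix_width p a i) \<le> 1 - prefix_width p a n" for n
  proof (induction n)
    case (Suc n)
    have "(\<Sum>i<Suc n. of_bool (a i) * p * prefix_width p a i)
        \<le> 1 - prefix_width p a n + of_bool (a n) * p * prefix_width p a n"
      using Suc by simp
    also have "\<dots> \<le> 1 - prefix_width p a (Suc n)"
      using assms prefix_width_nonneg[of p a n] mult_left_le[of p "prefix_width p a n"]
      by (auto simp: prefix_width_def algebra_simps)
    finally show ?case .
  qed (simp add: prefix_width_0)
  also have "1 - prefix_width p a n \<le> 1" for n
    using assms prefix_width_nonneg[of p a n] by simp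
  finally show ?thesis
    unfolding decode_def using assms by (intro suminf_le_const decode_summable)
qed

text \<open>Only the constant sequence of right turns decodes to the right end point: any left turn
  puts the point into an interval with another one to its right.\<close>

lemma decode_less_1:
  assumes "0 < p" "p < 1" "\<not> a m"
  shows "decode p a < 1"
  using assms(3)
proof (induction m arbitrary: a)
  case 0
  have "p * decode p (\<lambda>i. a (Suc i)) \<le> p * 1"
    using assms decode_le_1 by (intro mult_left_mono) auto
  also have "\<dots> < 1" using assms by simp
  finally show ?case
    using 0 assms(1,2) decode_unfold[of p a] by simp
next
  case (Suc m)
  let ?d = "decode p (\<lambda>i. a (Suc i))"
  have "?d < 1" using Suc.IH[of "\<lambda>i. a (Suc i)"] Suc.prems by simp
  then have "p * ?d < p" "(1 - p) * ?d < 1 - p"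
    using assms by simp_all
  then have "p * ?d < 1" "p + (1 - p) * ?d < 1"
    using assms by linarith+
  then show ?case
    using assms decode_unfold[of p a] by auto
qed

lemma expand_branches:
  assumes "0 < p" "p < 1"
  shows "x < 1 \<Longrightarrow> expand p (p * x) = x" "0 \<le> x \<Longrightarrow> expand p (p + (1 - p) * x) = x"
  using assms by (auto simp: expand_def)

lemma itinerary_left_branch:
  assumes "0 < p" "p < 1" "x < 1"
  shows "itinerary p (p * x) = case_nat False (itinerary p x)"
  using assms by (auto simp: itinerary_0 itinerary_Suc expand_branches fun_eq_iff split: nat.split)

lemma itinerary_right_branch:
  assumes "0 < p" "p < 1" "0 \<le> x"
  shows "itinerary p (p + (1 - p) * x) = case_nat True (itinerary p x)"
  using assms by (auto simp: itinerary_0 itinerary_Suc expand_branches fun_eq_iff split: nat.split)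

lemma expand_in_unit:
  assumes "0 < p" "p < 1" "x \<in> {0..<1}"
  shows "expand p x \<in> {0..<1}"
  using assms by (auto simp: expand_def)

text \<open>Tails of a sequence with infinitely many left turns have the same property, so they all decode
  to points strictly below \<open>1\<close>; this is what makes a left turn decode to a point strictly below
  the cut \<open>p\<close>.\<close>

lemma itinerary_decode:
  assumes p: "0 < p" "p < 1" and "\<And>m. \<exists>n\<ge>m. \<not> a n"
  shows "itinerary p (decode p a) = a"
proof
  fix n show "itinerary p (decode p a) n = a n"
    using assms(3)
  proof (induction n arbitrary: a)
    case (0 a)
    let ?b = "\<lambda>i. a (Suc i)"
    obtain n where "\<not> ?b n"
      using 0[of "Suc 0"] by (metis Suc_le_D)
    then have "p * decode p ?b < p * 1"
      using decode_less_1[OF p] p by (intro mult_strict_left_mono) auto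
    moreover have "0 \<le> (1 - p) * decode p ?b"
      using p decode_nonneg[OF p] by simp
    ultimately show ?case
      using decode_unfold[OF p, of a] by (auto simp: itinerary_0)
  next
    case (Suc n a)
    let ?b = "\<lambda>i. a (Suc i)"
    have tail: "\<exists>n\<ge>m. \<not> ?b n" for m
      using Suc.prems[of "Suc m"] by (metis Suc_le_D Suc_le_mono)
    then obtain k where "\<not> ?b k" by blast
    then have "expand p (decode p a) = decode p ?b"
      using decode_less_1[OF p] decode_nonneg[OF p] decode_unfold[OF p, of a]
      by (simp add: expand_branches[OF p])
    then show ?case
      using Suc.IH[OF tail] by (simp add: itinerary_Suc)
  qed
qed

lemma funpow_expand_in_unit:
  assumes "0 < p" "p < 1" "x \<in> {0..<1}"
  shows "(expand p ^^ n) x \<in> {0..<1}"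
  using assms by (induction n) (auto simp del: atLeastLessThan_iff intro!: expand_in_unit)

text \<open>Solving the definition of \<open>expand\<close> for the old point and iterating gives \<open>x\<close> as a partial sum
  of the series for \<open>decode\<close>, with the remainder equal to the prefix width times a point of the unit
  interval.\<close>

lemma decode_itinerary:
  assumes p: "0 < p" "p < 1" and x: "x \<in> {0..<1}"
  shows "decode p (itinerary p x) = x"
proof -
  let ?a = "itinerary p x"
  let ?s = "\<lambda>n. \<Sum>i<n. of_bool (?a i) * p * prefix_width p ?a i"
  let ?e = "\<lambda>n. prefix_width p ?a n * (expand p ^^ n) x"
  have step: "y = of_bool (p \<le> y) * p + (if p \<le> y then 1 - p else p) * expand p y" for y
    using p by (auto simp: expand_def)
  have "x = ?s n + ?e n" for n
  proof (induction n)
    case (Suc n)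
    let ?y = "(expand p ^^ n) x"
    have "?e n = of_bool (?a n) * p * prefix_width p ?a n + ?e (Suc n)"
      by (subst step[of ?y]) (simp add: itinerary_def prefix_width_def algebra_simps)
    then show ?case using Suc by simp
  qed (simp add: prefix_width_0)
  then have s: "?s n = x - ?e n" for n
    by (metis add_diff_cancel_right')
  have "?e \<longlonglongrightarrow> 0"
  proof (rule Lim_null_comparison)
    show "\<forall>\<^sub>F n in sequentially. norm (?e n) \<le> max p (1 - p) ^ n"
    proof (intro always_eventually allI)
      fix n
      have "?e n \<le> max p (1 - p) ^ n * 1"
        using p funpow_expand_in_unit[OF p x, of n]
        by (intro mult_mono prefix_width_le_power) auto
      then show "norm (?e n) \<le> max p (1 - p) ^ n"
        using p funpow_expand_in_unit[OF p x, of n] prefix_width_nonneg[of p ?a n] by simp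
    qed
    show "(\<lambda>n. max p (1 - p) ^ n) \<longlonglongrightarrow> 0"
      using p by (intro LIMSEQ_realpow_zero) auto
  qed
  then have "?s \<longlonglongrightarrow> x"
    unfolding s using tendsto_diff[OF tendsto_const[of x]] by fastforce
  then show ?thesis
    unfolding decode_def by (simp add: sums_def sums_unique[symmetric])
qed

text \<open>An orbit that only turns right from some time on would reach the point coded by the constant
  sequence of right turns; that point is \<open>1\<close>, which lies outside the half-open interval.\<close>

lemma itinerary_frequently_left:
  assumes p: "0 < p" "p < 1" and x: "x \<in> {0..<1}"
  shows "\<exists>n\<ge>m. \<not> itinerary p x n"
proof (rule ccontr)
  assume ones: "\<not> ?thesis"
  let ?y = "(expand p ^^ m) x" and ?d = "decode p (\<lambda>_. True)"
  have "itinerary p ?y = (\<lambda>_. True)"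
  proof
    fix n
    have "itinerary p x (m + n)" using ones by auto
    then show "itinerary p ?y n = True"
      by (simp add: itinerary_def add.commute[of m n] funpow_add)
  qed
  then have "?d = ?y"
    using decode_itinerary[OF p funpow_expand_in_unit[OF p x]] by metis
  moreover have "?d = 1"
    using decode_unfold[OF p, of "\<lambda>_. True"] p by (auto simp: algebra_simps)
  ultimately show False
    using funpow_expand_in_unit[OF p x, of m] by simp
qed

text \<open>The parameter is kept away from \<open>0\<close> and \<open>1\<close>, so that a geometric series dominates uniformly.\<close>

lemma continuous_on_decode:
  fixes f :: "'a::topological_space \<Rightarrow> real"
  assumes "continuous_on S f" "0 \<le> r" "r < 1"
    and "\<And>s. s \<in> S \<Longrightarrow> 0 \<le> f s \<and> f s \<le> 1 \<and> f s \<le> r \<and> 1 - f s \<le> r"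
  shows "continuous_on S (\<lambda>s. decode (f s) a)"
proof (rule uniform_limit_theorem)
  show "uniform_limit S (\<lambda>n s. \<Sum>i<n. of_bool (a i) * f s * prefix_width (f s) a i)
          (\<lambda>s. decode (f s) a) sequentially"
    unfolding decode_def
  proof (rule Weierstrass_m_test)
    show "norm (of_bool (a n) * f s * prefix_width (f s) a n) \<le> r ^ n" if "s \<in> S" for n s
      using assms(4)[OF that] by (intro decode_term_bound) auto
    show "summable (\<lambda>n. r ^ n)"
      using assms(2,3) by (intro summable_geometric) auto
  qed
  have "continuous_on S (\<lambda>s. prefix_width (f s) a i)" for i
    unfolding prefix_width_def
  proof (intro continuous_on_prod)
    show "continuous_on S (\<lambda>s. if a j then 1 - f s else f s)" for j
      by (cases "a j") (auto intro!: continuous_intros assms(1))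
  qed
  then show "\<forall>\<^sub>F n in sequentially. continuous_on S
        (\<lambda>s. \<Sum>i<n. of_bool (a i) * f s * prefix_width (f s) a i)"
    by (intro always_eventually allI continuous_intros assms(1))
qed simp

section \<open>The frequency of right turns\<close>

definition deviation :: "real \<Rightarrow> (nat \<Rightarrow> bool) \<Rightarrow> nat \<Rightarrow> real"
  where "deviation p a n = (\<Sum>i<n. of_bool (a i) - (1 - p))"

text \<open>It suffices to control the frequency at the times \<open>2 ^ k\<close>: along this subsequence the
  variances of the mean are summable, so second moments give almost sure convergence directly.\<close>

definition typical :: "real \<Rightarrow> real \<Rightarrow> bool"
  where "typical p x \<longleftrightarrow> (\<lambda>k. deviation p (itinerary p x) (2 ^ k) / 2 ^ k) \<longlonglongrightarrow> 0"

lemma deviation_case_nat: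
  "deviation p (case_nat b a) (Suc n) = of_bool b - (1 - p) + deviation p a n"
  unfolding deviation_def by (subst sum.lessThan_Suc_shift) simp

lemma borel_measurable_deviation:
  "(\<lambda>w. deviation (fst w) (itinerary (fst w) (snd w)) n) \<in> borel_measurable (borel \<Otimes>\<^sub>M borel)"
proof -
  have [measurable]: "(\<lambda>w. (expand (fst w) ^^ n) (snd w)) \<in> borel_measurable (borel \<Otimes>\<^sub>M borel)" for n
    by (induction n) (simp_all add: expand_def)
  show ?thesis
    unfolding deviation_def itinerary_def of_bool_def by measurable
qed

lemma borel_measurable_deviation_slice [measurable]:
  "(\<lambda>x. deviation p (itinerary p x) n) \<in> borel_measurable borel"
  using measurable_compose[OF measurable_Pair1' borel_measurable_deviation, of p n] by simp

lemma pred_typical: "Measurable.pred (borel \<Otimes>\<^sub>M borel) (\<lambda>w. typical (fst w) (snd w))"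
proof -
  note borel_measurable_deviation[measurable]
  show ?thesis unfolding typical_def by measurable
qed

text \<open>Lebesgue measure on the unit interval is self-similar under the two inverse branches; this
  stands in for the independence of the bits.\<close>

lemma nn_integral_unit_branches:
  fixes f :: "real \<Rightarrow> ennreal"
  assumes [measurable]: "f \<in> borel_measurable borel" and p: "0 < p" "p < 1"
  shows "(\<integral>\<^sup>+x\<in>{0..<1}. f x \<partial>lborel)
    = ennreal p * (\<integral>\<^sup>+x\<in>{0..<1}. f (p * x) \<partial>lborel)
      + ennreal (1 - p) * (\<integral>\<^sup>+x\<in>{0..<1}. f (p + (1 - p) * x) \<partial>lborel)"
proof -
  have "(\<integral>\<^sup>+x\<in>{0..<1}. f x \<partial>lborel) = (\<integral>\<^sup>+x\<in>{0..<p} \<union> {p..<1}. f x \<partial>lborel)"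
    using p by (simp add: ivl_disj_un)
  also have "\<dots> = (\<integral>\<^sup>+x\<in>{0..<p}. f x \<partial>lborel) + (\<integral>\<^sup>+x\<in>{p..<1}. f x \<partial>lborel)"
    by (rule nn_integral_disjoint_pair) auto
  also have "(\<integral>\<^sup>+x\<in>{0..<p}. f x \<partial>lborel)
      = ennreal p * (\<integral>\<^sup>+x. f (p * x) * indicator {0..<p} (p * x) \<partial>lborel)"
    using p by (subst nn_integral_real_affine[where c = p and t = 0]) auto
  also have "(\<lambda>x. indicator {0..<p} (p * x) :: ennreal) = indicator {0..<1}"
    using p by (auto simp: indicator_def fun_eq_iff zero_le_mult_iff)
  also have "(\<integral>\<^sup>+x\<in>{p..<1}. f x \<partial>lborel) = ennreal (1 - p)
      * (\<integral>\<^sup>+x. f (p + (1 - p) * x) * indicator {p..<1} (p + (1 - p) * x) \<partial>lborel)"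
    using p by (subst nn_integral_real_affine[where c = "1 - p" and t = p]) auto
  also have "(\<lambda>x. indicator {p..<1} (p + (1 - p) * x) :: ennreal) = indicator {0..<1}"
  proof -
    have "p + (1 - p) * x < 1 \<longleftrightarrow> x < 1" for x
      using p mult_less_cancel_left_pos[of "1 - p" x 1] by (simp add: less_diff_eq add.commute)
    then show ?thesis
      using p by (auto simp: indicator_def fun_eq_iff zero_le_mult_iff)
  qed
  finally show ?thesis .
qed

text \<open>This is the variance of a sum of \<open>n\<close> independent coin flips.  The constant \<open>c\<close> makes the
  induction close: the first bit changes the offset to \<open>c - (1 - p)\<close> or \<open>c + p\<close>, and the
  expected square of the new offset is \<open>c\<^sup>2 + p (1 - p)\<close>.\<close>

lemma deviation_second_moment:
  assumes p: "0 < p" "p < 1"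
  shows "(\<integral>\<^sup>+x\<in>{0..<1}. ennreal ((deviation p (itinerary p x) n + c)\<^sup>2) \<partial>lborel)
    = ennreal (n * p * (1 - p) + c\<^sup>2)"
proof (induction n arbitrary: c)
  case 0
  show ?case by (simp add: deviation_def nn_integral_cmult_indicator)
next
  case (Suc n)
  let ?D = "\<lambda>c x. ennreal ((deviation p (itinerary p x) n + c)\<^sup>2)"
  let ?F = "\<lambda>x. ennreal ((deviation p (itinerary p x) (Suc n) + c)\<^sup>2)"
  have "(\<integral>\<^sup>+x\<in>{0..<1}. ?F x \<partial>lborel)
    = ennreal p * (\<integral>\<^sup>+x\<in>{0..<1}. ?F (p * x) \<partial>lborel)
      + ennreal (1 - p) * (\<integral>\<^sup>+x\<in>{0..<1}. ?F (p + (1 - p) * x) \<partial>lborel)"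
    by (rule nn_integral_unit_branches[OF _ p]) measurable
  also have "(\<integral>\<^sup>+x\<in>{0..<1}. ?F (p * x) \<partial>lborel) = (\<integral>\<^sup>+x\<in>{0..<1}. ?D (c - (1 - p)) x \<partial>lborel)"
    by (intro nn_integral_cong)
       (auto simp: itinerary_left_branch[OF p] deviation_case_nat add_ac add_diff_eq diff_add_eq diff_diff_eq2 split: split_indicator)
  also have "(\<integral>\<^sup>+x\<in>{0..<1}. ?F (p + (1 - p) * x) \<partial>lborel) = (\<integral>\<^sup>+x\<in>{0..<1}. ?D (c + p) x \<partial>lborel)"
    by (intro nn_integral_cong)
       (auto simp: itinerary_right_branch[OF p] deviation_case_nat add_ac split: split_indicator)
  also have "ennreal p * (\<integral>\<^sup>+x\<in>{0..<1}. ?D (c - (1 - p)) x \<partial>lborel)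
        + ennreal (1 - p) * (\<integral>\<^sup>+x\<in>{0..<1}. ?D (c + p) x \<partial>lborel)
      = ennreal (p * (n * p * (1 - p) + (c - (1 - p))\<^sup>2)
          + (1 - p) * (n * p * (1 - p) + (c + p)\<^sup>2))"
    unfolding Suc.IH using p by (simp add: ennreal_mult ennreal_plus)
  also have "p * (n * p * (1 - p) + (c - (1 - p))\<^sup>2) + (1 - p) * (n * p * (1 - p) + (c + p)\<^sup>2)
      = Suc n * p * (1 - p) + c\<^sup>2"
    by (simp add: power2_eq_square algebra_simps)
  finally show ?case .
qed

text \<open>The squared errors of the empirical frequency at the times \<open>2 ^ k\<close> have a finite total integral.
  So their sum is finite almost everywhere, and its terms tend to zero.\<close>

lemma AE_typical:
  assumes p: "0 < p" "p < 1"
  shows "AE x in lborel. x \<in> {0..<1} \<longrightarrow> typical p x"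
proof -
  let ?f = "\<lambda>x k. (deviation p (itinerary p x) (2 ^ k) / 2 ^ k)\<^sup>2"
  have moment: "(\<integral>\<^sup>+x\<in>{0..<1}. ennreal (?f x k) \<partial>lborel) = ennreal (p * (1 - p) * (1 / 2) ^ k)" for k
  proof -
    have "(d / 2 ^ k)\<^sup>2 = (1 / 4) ^ k * d\<^sup>2" for d :: real
    proof -
      have "(4::real) ^ k = 2 ^ k * 2 ^ k"
        by (simp flip: power_mult_distrib)
      then show ?thesis by (simp add: power2_eq_square power_divide)
    qed
    then have "(\<integral>\<^sup>+x\<in>{0..<1}. ennreal (?f x k) \<partial>lborel)
      = (\<integral>\<^sup>+x. ennreal ((1 / 4) ^ k) *
          (ennreal ((deviation p (itinerary p x) (2 ^ k) + 0)\<^sup>2) * indicator {0..<1} x) \<partial>lborel)"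
      by (simp add: ennreal_mult mult.assoc)
    also have "\<dots> = ennreal ((1 / 4) ^ k)
        * (\<integral>\<^sup>+x\<in>{0..<1}. ennreal ((deviation p (itinerary p x) (2 ^ k) + 0)\<^sup>2) \<partial>lborel)"
      by (rule nn_integral_cmult) measurable
    also have "\<dots> = ennreal ((1 / 4) ^ k * (2 ^ k * p * (1 - p)))"
      unfolding deviation_second_moment[OF p] using p by (simp add: ennreal_mult)
    also have "(1 / 4) ^ k * (2 ^ k * p * (1 - p)) = (1 / 4 * 2) ^ k * (p * (1 - p))"
      unfolding power_mult_distrib by (simp only: mult.assoc)
    also have "\<dots> = p * (1 - p) * (1 / 2) ^ k"
      by (simp add: mult.commute)
    finally show ?thesis .
  qed
  have "(\<integral>\<^sup>+x. (\<Sum>k. ennreal (?f x k) * indicator {0..<1} x) \<partial>lborel)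
      = (\<Sum>k. ennreal (p * (1 - p) * (1 / 2) ^ k))"
    by (subst nn_integral_suminf) (simp_all add: moment)
  also have "\<dots> \<noteq> \<infinity>"
  proof -
    have "summable (\<lambda>k. p * (1 - p) * (1 / 2) ^ k)"
      by (intro summable_mult summable_geometric) simp
    then show ?thesis
      using p by (subst suminf_ennreal2) auto
  qed
  finally have "AE x in lborel. (\<Sum>k. ennreal (?f x k) * indicator {0..<1} x) \<noteq> \<infinity>"
    by (intro nn_integral_PInf_AE) simp_all
  then show ?thesis
  proof eventually_elim
    case (elim x)
    show ?case
    proof
      assume "x \<in> {0..<1}"
      then have "summable (?f x)"
        using elim by (intro summable_suminf_not_top) auto
      then show "typical p x"
        unfolding typical_def using summable_LIMSEQ_zero tendsto_power_zero by fastforce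
    qed
  qed
qed

lemma typical_weight_unique:
  assumes "typical p x" "typical q y" "itinerary p x = itinerary q y"
  shows "p = q"
proof -
  have "(\<lambda>k. deviation p (itinerary p x) (2 ^ k) / 2 ^ k
           - deviation q (itinerary p x) (2 ^ k) / 2 ^ k) \<longlonglongrightarrow> 0 - 0"
    using assms unfolding typical_def by (intro tendsto_diff) auto
  moreover have "deviation p a n / n - deviation q a n / n = p - q" if "n > 0" for a and n :: nat
    using that by (simp add: deviation_def sum_subtractf diff_divide_distrib)
  from this[of "2 ^ k" for k]
  have "(\<lambda>k. deviation p (itinerary p x) (2 ^ k) / 2 ^ k
           - deviation q (itinerary p x) (2 ^ k) / 2 ^ k) = (\<lambda>k. p - q)"
    by auto
  ultimately show ?thesis
    by (simp add: LIMSEQ_const_iff)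
qed

section \<open>Coordinates on the torus\<close>

definition first_coord :: "torus2 \<Rightarrow> real"
  where "first_coord z = frac (fst (rep_torus2 z))"

definition second_coord :: "torus2 \<Rightarrow> real"
  where "second_coord z = frac (snd (rep_torus2 z))"

lemma torus_proj_rep: "torus_proj (rep_torus2 z) = z"
  unfolding torus_proj_def by (rule Quotient_abs_rep[OF Quotient_torus2])

lemma frac_eq_if_diff_Ints:
  assumes "x - y \<in> \<int>"
  shows "frac x = frac (y::real)"
  using assms by (metis Ints_cases diff_add_cancel frac_add_int_left)

lemma coords_torus_proj:
  "first_coord (torus_proj v) = frac (fst v)" "second_coord (torus_proj v) = frac (snd v)"
  using torus_proj_rep[of "torus_proj v"] unfolding torus_proj_eq_iff int_equiv_def
  by (auto simp: first_coord_def second_coord_def intro: frac_eq_if_diff_Ints)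

lemma torus_proj_coords: "torus_proj (first_coord z, second_coord z) = z"
proof -
  have "frac x - x \<in> \<int>" for x :: real
    by (simp add: frac_def)
  then have "torus_proj (first_coord z, second_coord z) = torus_proj (rep_torus2 z)"
    unfolding torus_proj_eq_iff by (simp add: int_equiv_def first_coord_def second_coord_def)
  then show ?thesis by (simp add: torus_proj_rep)
qed

lemma first_coord_in_unit: "first_coord z \<in> {0..<1}"
  by (simp add: first_coord_def frac_lt_1)

lemma second_coord_in_unit: "second_coord z \<in> {0..<1}"
  by (simp add: second_coord_def frac_lt_1)

text \<open>The coordinate jumps along the circle where it vanishes, but it is continuous off that circle,
  and the circle is closed.\<close>

lemma borel_measurable_first_coord [measurable]: "first_coord \<in> borel_measurable borel"
proof -
  have op: "open {z. 0 < first_coord z \<and> first_coord z < a}" for a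
  proof -
    have "{x::real. 0 < frac x \<and> frac x < a} = (\<Union>n::int. {of_int n<..<of_int n + min 1 a})"
    proof (intro equalityI subsetI)
      fix x :: real assume "x \<in> {x. 0 < frac x \<and> frac x < a}"
      then have "x \<in> {of_int \<lfloor>x\<rfloor><..<of_int \<lfloor>x\<rfloor> + min 1 a}"
        using frac_lt_1[of x] by (auto simp: frac_def)
      then show "x \<in> (\<Union>n::int. {of_int n<..<of_int n + min 1 a})" by blast
    next
      fix x :: real assume "x \<in> (\<Union>n::int. {of_int n<..<of_int n + min 1 a})"
      then obtain n :: int where n: "of_int n < x" "x < of_int n + min 1 a" by auto
      then have "\<lfloor>x\<rfloor> = n" by linarith
      then show "x \<in> {x. 0 < frac x \<and> frac x < a}" using n by (auto simp: frac_def)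
    qed
    then have "open {x::real. 0 < frac x \<and> frac x < a}"
      by (simp only: open_UN open_greaterThanLessThan simp_thms ball_simps)
    then have "open (fst -` {x::real. 0 < frac x \<and> frac x < a} :: (real \<times> real) set)"
      by (rule open_vimage_fst)
    then show ?thesis
      by (simp add: open_torus2_def vimage_def coords_torus_proj)
  qed
  have "{z. first_coord z < a} \<in> sets borel" for a
  proof (cases "0 < a")
    case True
    have "{z. first_coord z < a}
        = - {z. 0 < first_coord z \<and> first_coord z < 1} \<union> {z. 0 < first_coord z \<and> first_coord z < a}"
      using first_coord_in_unit True by (auto simp: not_less order_le_less)
    also have "\<dots> \<in> sets borel"
      using op by (intro sets.Un borel_comp borel_open)
    finally show ?thesis .
  next
    case False
    then have "{z. first_coord z < a} = {}"
      using first_coord_in_unit by (auto simp: not_less) (metis atLeastLessThan_iff leD order_trans)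
    then show ?thesis by simp
  qed
  then show ?thesis by (simp add: borel_measurable_iff_less)
qed

lemma AE_first_coord:
  assumes "AE x in lborel. x \<in> {0..<1} \<longrightarrow> P x" and [measurable]: "Measurable.pred borel P"
  shows "AE z in torus_lborel. P (first_coord z)"
proof -
  let ?Q = "{0..<1} \<times> {0..<1} :: (real \<times> real) set"
  have "AE v in lborel \<Otimes>\<^sub>M (lborel :: real measure). fst v \<in> {0..<1} \<longrightarrow> P (fst v)"
  proof (rule lborel_pair.AE_pair_measure)
    show "AE x in lborel. AE y in lborel. fst (x, y) \<in> {0..<1} \<longrightarrow> P (fst (x, y))"
      using assms(1) by eventually_elim simp
  qed measurable
  then have "AE v in lborel. v \<in> ?Q \<longrightarrow> P (frac (fst v))"
    unfolding lborel_prod by eventually_elim (auto simp: frac_eq)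
  then have "AE v in restrict_space lborel ?Q. P (frac (fst v))"
    by (subst AE_restrict_space_iff) (auto simp: borel_Times)
  then show ?thesis
    unfolding torus_lborel_def
    by (subst AE_distr_iff[OF torus_proj_measurable]) (simp_all add: coords_torus_proj)
qed

lemma finite_measure_torus_lborel: "finite_measure torus_lborel"
proof -
  have "bounded ({0..<1} \<times> {0..<1} :: (real \<times> real) set)"
    by (simp add: bounded_Times)
  then have "finite_measure (restrict_space lborel ({0..<1} \<times> {0..<1} :: (real \<times> real) set))"
    using emeasure_bounded_finite
    by (intro finite_measureI) (auto simp: space_restrict_space emeasure_restrict_space borel_Times less_top)
  then show ?thesis
    unfolding torus_lborel_def by (rule finite_measure.finite_measure_distr[OF _ torus_proj_measurable])
qed

section \<open>The decomposition into curves\<close>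

text \<open>Any continuous injection of \<open>[0,1]\<close> into a compact part of \<open>(0,1)\<close> would do.\<close>

definition weight :: "real \<Rightarrow> real"
  where "weight t = (1 + t) / 3"

definition code :: "real \<times> torus2 \<Rightarrow> (nat \<Rightarrow> bool) \<times> real"
  where "code w = (itinerary (weight (fst w)) (first_coord (snd w)), second_coord (snd w))"

lemma weight_bounds:
  assumes "t \<in> {0..1}"
  shows "1 / 3 \<le> weight t" "weight t \<le> 2 / 3" "0 < weight t" "weight t < 1"
  using assms by (auto simp: weight_def)

lemma continuous_on_weight: "continuous_on S weight"
  unfolding weight_def by (intro continuous_intros) auto

lemma full_measure_typical:
  "full_measure {w \<in> {0..1} \<times> UNIV. typical (weight (fst w)) (first_coord (snd w))}"
proof -
  let ?M = "restrict_space lborel {0..1::real} \<Otimes>\<^sub>M torus_lborel"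
  let ?P = "\<lambda>w. typical (weight (fst w)) (first_coord (snd w))"
  have sets_T: "sets torus_lborel = sets borel" by (simp add: torus_lborel_def)
  interpret T: finite_measure torus_lborel
    by (rule finite_measure_torus_lborel)
  interpret L: sigma_finite_measure "restrict_space lborel {0..1::real}"
    by (rule sigma_finite_measure_restrict_space) (auto intro: lborel.sigma_finite_measure_axioms)
  interpret pair_sigma_finite "restrict_space lborel {0..1::real}" torus_lborel ..
  have space: "space ?M = {0..1} \<times> UNIV"
    by (simp add: space_pair_measure torus_lborel_def space_restrict_space)
  have c: "first_coord \<in> borel_measurable torus_lborel"
    using borel_measurable_first_coord by (simp add: measurable_cong_sets[OF sets_T refl])
  have [measurable]: "weight \<in> borel_measurable (restrict_space lborel {0..1})"
    by (intro measurable_restrict_space1)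
       (simp add: borel_measurable_continuous_onI continuous_on_weight)
  have P: "Measurable.pred ?M ?P"
  proof -
    have "(\<lambda>w. (weight (fst w), first_coord (snd w))) \<in> ?M \<rightarrow>\<^sub>M borel \<Otimes>\<^sub>M borel"
      using c by measurable
    from measurable_compose[OF this pred_typical] show ?thesis by simp
  qed
  have "AE z in torus_lborel. ?P (t, z)" if "t \<in> {0..1}" for t
  proof -
    have "Measurable.pred borel (typical (weight t))"
      using measurable_compose[OF measurable_Pair1' pred_typical, of "weight t"] by simp
    then show ?thesis
      using AE_first_coord[OF AE_typical] weight_bounds[OF that] by simp
  qed
  then have "AE t in restrict_space lborel {0..1}. AE z in torus_lborel. ?P (t, z)"
    by (subst AE_restrict_space_iff) auto
  then have ae: "AE w in ?M. ?P w"
    using P by (intro AE_pair_measure) (auto simp: pred_def)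
  have "{w \<in> {0..1} \<times> UNIV. ?P w} \<in> sets ?M"
    using P unfolding pred_def space .
  moreover from ae
  have "emeasure ?M ({0..1} \<times> UNIV - {w \<in> {0..1} \<times> UNIV. ?P w}) = 0"
    unfolding space[symmetric] set_diff_eq by (intro emeasure_eq_0_AE) auto
  ultimately show ?thesis
    unfolding full_measure_def space_cylinder_lebesgue
    unfolding cylinder_lebesgue_def space[symmetric]
    by (simp add: sets_completionI_sets)
qed

text \<open>The fibre through \<open>w\<close> consists of the points that decode the bit sequence of \<open>w\<close>, one for
  every time.\<close>

lemma code_fibre_curve:
  assumes "w \<in> {0..1} \<times> UNIV"
  shows "curve_in_cylinder {v \<in> {0..1} \<times> UNIV. code v = code w}"
proof -
  obtain t\<^sub>0 z\<^sub>0 where w: "w = (t\<^sub>0, z\<^sub>0)" "t\<^sub>0 \<in> {0..1}" using assms by auto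
  define a where "a = itinerary (weight t\<^sub>0) (first_coord z\<^sub>0)"
  define y where "y = second_coord z\<^sub>0"
  define g where "g t = (t, torus_proj (decode (weight t) a, y))" for t
  have code_w: "code w = (a, y)" by (simp add: code_def w a_def y_def)
  have y: "y \<in> {0..<1}" by (simp add: y_def second_coord_in_unit del: atLeastLessThan_iff)
  have a: "\<exists>n\<ge>m. \<not> a n" for m
    unfolding a_def by (rule itinerary_frequently_left[OF weight_bounds(3,4)[OF w(2)] first_coord_in_unit])
  have "arc g"
    unfolding arc_def path_def
  proof
    show "continuous_on {0..1} g"
      unfolding g_def using weight_bounds
      by (intro continuous_on_Pair continuous_on_id continuous_on_compose2[OF continuous_on_torus_proj[of UNIV]]
          continuous_on_decode[where r = "2/3"] continuous_on_weight continuous_on_const) (auto simp: weight_def)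
    show "inj_on g {0..1}" by (auto simp: inj_on_def g_def)
  qed
  moreover have "path_image g = {v \<in> {0..1} \<times> UNIV. code v = code w}"
  proof (intro equalityI subsetI)
    fix v assume "v \<in> path_image g"
    then obtain t where t: "t \<in> {0..1}" "v = g t" by (auto simp: path_image_def)
    note p = weight_bounds(3,4)[OF t(1)]
    obtain m where "\<not> a m" using a by blast
    then have "decode (weight t) a \<in> {0..<1}"
      using decode_nonneg[OF p] decode_less_1[OF p] by auto
    then have "code v = (a, y)"
      using y by (simp add: code_def t(2) g_def coords_torus_proj frac_eq itinerary_decode[OF p a])
    then show "v \<in> {v \<in> {0..1} \<times> UNIV. code v = code w}"
      using t code_w by (simp add: g_def)
  next
    fix v assume "v \<in> {v \<in> {0..1} \<times> UNIV. code v = code w}"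
    then obtain t z where v: "v = (t, z)" "t \<in> {0..1}" "itinerary (weight t) (first_coord z) = a"
        "second_coord z = y"
      using code_w by (cases v) (auto simp: code_def)
    have "decode (weight t) a = first_coord z"
      using decode_itinerary[OF weight_bounds(3,4)[OF v(2)] first_coord_in_unit] v(3) by metis
    then have "v = g t" using v torus_proj_coords[of z] by (simp add: g_def)
    then show "v \<in> path_image g" using v(2) by (auto simp: path_image_def)
  qed
  ultimately show ?thesis by (auto simp: curve_in_cylinder_def)
qed

theorem theorem1p1:
  shows "\<exists>(E :: (real \<times> torus2) set) (\<Gamma> :: (real \<times> torus2) set set).
    full_measure E \<and>
    (\<forall>C\<in>\<Gamma>. curve_in_cylinder C) \<and>
    disjoint \<Gamma> \<and>
    \<Union>\<Gamma> = {0..1} \<times> UNIV \<and>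
    (\<forall>C\<in>\<Gamma>. \<forall>p\<in>C \<inter> E. \<forall>q\<in>C \<inter> E. p = q)"
proof -
  \<comment> \<open>The nonempty fibres of a map always form a partition of its domain.\<close>
  define X :: "(real \<times> torus2) set" where "X = {0..1} \<times> UNIV"
  define E where "E = {w \<in> X. typical (weight (fst w)) (first_coord (snd w))}"
  define \<Gamma> where "\<Gamma> = (\<lambda>w. {v \<in> X. code v = code w}) ` X"
  have "full_measure E" using full_measure_typical by (simp add: E_def X_def)
  moreover have "\<forall>C\<in>\<Gamma>. curve_in_cylinder C"
    using code_fibre_curve by (auto simp: \<Gamma>_def X_def)
  moreover have "disjoint \<Gamma>" by (auto simp: \<Gamma>_def disjoint_def)
  moreover have "\<Union>\<Gamma> = {0..1} \<times> UNIV" by (auto simp: \<Gamma>_def X_def)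
  moreover have "v = w" if vw: "v \<in> E" "w \<in> E" "code v = code w" for v w
  proof -
    obtain s y t z where [simp]: "v = (s, y)" "w = (t, z)" by (cases v, cases w)
    have it: "itinerary (weight s) (first_coord y) = itinerary (weight t) (first_coord z)"
      and second: "second_coord y = second_coord z"
      using vw(3) by (auto simp: code_def)
    have s: "s \<in> {0..1}" and "typical (weight s) (first_coord y)" "typical (weight t) (first_coord z)"
      using vw by (auto simp: E_def X_def)
    then have "weight s = weight t" using it by (blast intro: typical_weight_unique)
    then have "s = t" by (simp add: weight_def)
    have "first_coord y = first_coord z"
      using it decode_itinerary[OF weight_bounds(3,4)[OF s] first_coord_in_unit] unfolding \<open>s = t\<close>
      by metis
    then have "y = z" using second torus_proj_coords by metis
    with \<open>s = t\<close> show ?thesis by simp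
  qed
  then have "\<forall>C\<in>\<Gamma>. \<forall>p\<in>C \<inter> E. \<forall>q\<in>C \<inter> E. p = q"
    unfolding \<Gamma>_def by (auto simp: image_iff)
  ultimately show ?thesis by blast
qed

end
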